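(* Let $\mathbb X$ be a separable infinite-dimensional Banach space over $\mathbb F=\mathbb R$ or $\mathbb C$ with a semi-normalized Markushevich basis $\mathcal B=(\mathbf e_i)_{i\in\mathbb N}$, let $\mathbf n=(n_i)_{i\in\mathbb N}$ be a strictly increasing sequence of positive integers, and let $0<t\le 1$. If $\mathcal B$ is $1$-$\mathbf n$-$t$-suppression-quasi-greedy, then $\mathcal B$ is quasi-greedy.
   Context: A semi-normalized Markushevich basis of $\mathbb X$ is a sequence $(\mathbf e_i)_{i\in\mathbb N}\subset\mathbb X$ with dense linear span, for which there is a (unique) sequence of biorthogonal functionals $(\mathbf e_i^* )_{i\in\mathbb N}\subset\mathbb X^*$ with $\mathbf e_k^*(\mathbf e_i)=\delta_{k,i}$, such that $\mathbf e_i^*(x)=0$ for all $i$ implies $x=0$, and $\sup_i\{\|\mathbf e_i\|,\|\mathbf e_i^*\|\}<\infty$. For a finite set $A\subset\mathbb N$, $P_A(x)=\sum_{i\in A}\mathbf e_i^*(x)\mathbf e_i$. For $0<t\le1$, a finite set $A\subset\mathbb N$ is a $t$-greedy set for $x\in\mathbb X$ if $\min_{i\in A}|\mathbf e_i^*(x)|\ge t\max_{i\notin A}|\mathbf e_i^*(x)|$, i.e. $|\mathbf e_i^*(x)|\ge t|\mathbf e_j^*(x)|$ for all $i\in A$, $j\notin A$. If $t=1$, one says greedy set. $\mathcal B$ is $C$-$\mathbf n$-$t$-suppression-quasi-greedy if $C$ is the smallest constant such that $\|x-P_A(x)\|\le C\|x\|$ for all $x\in\mathbb X$ and all $t$-greedy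 sets $A$ for $x$ with $|A|\in\mathbf n$ (that is, $|A|=n_k$ for some $k$). $\mathcal B$ is quasi-greedy if there is $C>0$ such that $\|P_A(x)\|\le C\|x\|$ for all $x\in\mathbb X$ and all (finite) greedy sets $A$ for $x$. *)

theory Defs
  imports "HOL-Analysis.Analysis"
begin

(* The scalar field is a type of class real_normed_field, of which real and complex are
   instances. The norm of that class is multiplicative, so by Gelfand-Mazur every such
   field is isometrically isomorphic to one of these two. The class banach only provides
   the real scalar multiplication; smul_of_real makes it agree with that over 'k. *)
locale banach_space_over = vector_space smul
  for smul :: "'k::real_normed_field \<Rightarrow> 'a::banach \<Rightarrow> 'a" +
  assumes smul_of_real: "smul (of_real r) x = r *\<^sub>R x"
    and norm_smul: "norm (smul c x) = norm c * norm x"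

definition infinite_dimensional ::
    "('k::real_normed_field \<Rightarrow> 'a::banach \<Rightarrow> 'a) \<Rightarrow> bool" where
  "infinite_dimensional smul \<longleftrightarrow> \<not> (\<exists>B. finite B \<and> module.span smul B = UNIV)"

definition continuous_functional ::
    "('k::real_normed_field \<Rightarrow> 'a::banach \<Rightarrow> 'a) \<Rightarrow> ('a \<Rightarrow> 'k) \<Rightarrow> bool" where
  "continuous_functional smul f \<longleftrightarrow> Vector_Spaces.linear smul (*) f \<and> bounded_linear f"

(* By density of the span, e determines the biorthogonal functionals es; they are carried
   as a separate argument. *)
definition semi_normalized_markushevich_basis ::
    "('k::real_normed_field \<Rightarrow> 'a::banach \<Rightarrow> 'a) \<Rightarrow> (nat \<Rightarrow> 'a) \<Rightarrow> (nat \<Rightarrow> 'a \<Rightarrow> 'k) \<Rightarrow> bool"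
  where
  "semi_normalized_markushevich_basis smul e es \<longleftrightarrow>
     closure (module.span smul (range e)) = UNIV \<and>
     (\<forall>i. continuous_functional smul (es i)) \<and>
     (\<forall>k i. es k (e i) = (if k = i then 1 else 0)) \<and>
     (\<forall>x. (\<forall>i. es i x = 0) \<longrightarrow> x = 0) \<and>
     bdd_above (range (\<lambda>i. norm (e i))) \<and>
     bdd_above (range (\<lambda>i. onorm (es i)))"

definition coord_proj ::
    "('k::real_normed_field \<Rightarrow> 'a::banach \<Rightarrow> 'a) \<Rightarrow> (nat \<Rightarrow> 'a) \<Rightarrow> (nat \<Rightarrow> 'a \<Rightarrow> 'k)
     \<Rightarrow> nat set \<Rightarrow> 'a \<Rightarrow> 'a" where
  "coord_proj smul e es A x = (\<Sum>i\<in>A. smul (es i x) (e i))"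

definition greedy_set ::
    "(nat \<Rightarrow> 'a::banach \<Rightarrow> 'k::real_normed_field) \<Rightarrow> real \<Rightarrow> 'a \<Rightarrow> nat set \<Rightarrow> bool" where
  "greedy_set es t x A \<longleftrightarrow>
     finite A \<and> (\<forall>i\<in>A. \<forall>j. j \<notin> A \<longrightarrow> norm (es i x) \<ge> t * norm (es j x))"

definition suppression_bound ::
    "('k::real_normed_field \<Rightarrow> 'a::banach \<Rightarrow> 'a) \<Rightarrow> (nat \<Rightarrow> 'a) \<Rightarrow> (nat \<Rightarrow> 'a \<Rightarrow> 'k)
     \<Rightarrow> (nat \<Rightarrow> nat) \<Rightarrow> real \<Rightarrow> real \<Rightarrow> bool" where
  "suppression_bound smul e es n t C \<longleftrightarrow>
     (\<forall>x A. greedy_set es t x A \<and> card A \<in> range n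
        \<longrightarrow> norm (x - coord_proj smul e es A x) \<le> C * norm x)"

definition suppression_quasi_greedy ::
    "('k::real_normed_field \<Rightarrow> 'a::banach \<Rightarrow> 'a) \<Rightarrow> (nat \<Rightarrow> 'a) \<Rightarrow> (nat \<Rightarrow> 'a \<Rightarrow> 'k)
     \<Rightarrow> (nat \<Rightarrow> nat) \<Rightarrow> real \<Rightarrow> real \<Rightarrow> bool" where
  "suppression_quasi_greedy smul e es n t C \<longleftrightarrow>
     suppression_bound smul e es n t C \<and>
     (\<forall>C'. suppression_bound smul e es n t C' \<longrightarrow> C \<le> C')"

definition quasi_greedy ::
    "('k::real_normed_field \<Rightarrow> 'a::banach \<Rightarrow> 'a) \<Rightarrow> (nat \<Rightarrow> 'a) \<Rightarrow> (nat \<Rightarrow> 'a \<Rightarrow> 'k) \<Rightarrow> bool"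
  where
  "quasi_greedy smul e es \<longleftrightarrow>
     (\<exists>C>0. \<forall>x A. greedy_set es 1 x A \<longrightarrow> norm (coord_proj smul e es A x) \<le> C * norm x)"

end

(* Put m = n 0. A greedy set A with at least m elements contains a greedy set B with exactly m
   elements, and removing B does not increase the norm. What is left of A is greedy for what is
   left of x, so this repeats until fewer than m indices remain. Since the basis is
   semi-normalized, those cost at most a constant times m. *)
theory Submission
  imports Defs
begin

text \<open>The set grows one element at a time by adjoining a maximizer \<open>k\<close> of
  \<open>f\<close> on \<open>A - B\<close>. The old elements already dominate \<open>k\<close>, and
  \<open>k\<close> dominates what remains.\<close>

lemma exists_largest_subset:
  fixes f :: "'b \<Rightarrow> 'c::linorder"
  assumes "finite A" and "m \<le> card A"
  shows "\<exists>B\<subseteq>A. card B = m \<and> (\<forall>i\<in>B. \<forall>j\<in>A - B. f j \<le> f i)"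
  using assms(2)
proof (induction m)
  case 0
  show ?case by (rule exI[of _ "{}"]) simp
next
  case (Suc m)
  then obtain B where B: "B \<subseteq> A" "card B = m" "\<And>i j. i \<in> B \<Longrightarrow> j \<in> A - B \<Longrightarrow> f j \<le> f i"
    by auto
  have "finite B" using B(1) assms(1) finite_subset by blast
  have "A - B \<noteq> {}" using B Suc.prems by (metis Diff_eq_empty_iff Suc_n_not_le_n subset_antisym)
  then have "Max (f ` (A - B)) \<in> f ` (A - B)" using assms(1) by (intro Max_in) auto
  then obtain k where k: "k \<in> A - B" "f k = Max (f ` (A - B))" by auto
  then have max: "f j \<le> f k" if "j \<in> A - B" for j using that assms(1) by simp
  show ?case
    using B k(1) max \<open>finite B\<close> by (intro exI[of _ "insert k B"]) auto
qed

text \<open>Take \<open>m\<close> elements of \<open>A\<close> with the largest coefficients. They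
  dominate the rest of \<open>A\<close> by choice, and everything outside \<open>A\<close> because
  \<open>A\<close> is greedy.\<close>

lemma greedy_set_subset:
  assumes "greedy_set es 1 x A" and "m \<le> card A"
  obtains B where "B \<subseteq> A" "card B = m" "greedy_set es 1 x B"
proof -
  have fin: "finite A" using assms(1) by (simp add: greedy_set_def)
  obtain B where B: "B \<subseteq> A" "card B = m"
      "\<forall>i\<in>B. \<forall>j\<in>A - B. norm (es j x) \<le> norm (es i x)"
    using exists_largest_subset[OF fin assms(2), of "\<lambda>i. norm (es i x)"] by blast
  moreover have "greedy_set es 1 x B"
    using assms(1) B finite_subset[OF B(1) fin] unfolding greedy_set_def by fastforce
  ultimately show thesis using that by blast
qed

text \<open>With \<open>s = 1\<close> this brings ordinary greedy sets within reach of a hypothesis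
  on \<open>t\<close>-greedy sets.\<close>

lemma greedy_set_mono:
  assumes "greedy_set es s x A" and "t \<le> s"
  shows "greedy_set es t x A"
  using assms mult_right_mono[OF assms(2) norm_ge_zero]
  unfolding greedy_set_def by (meson order_trans)

lemma biorthogonal_coord_residual:
  fixes smul :: "'k::real_normed_field \<Rightarrow> 'a::banach \<Rightarrow> 'a"
  assumes "continuous_functional smul (es i)"
    and "\<And>k i. es k (e i) = (if k = i then 1 else 0)" and "finite B"
  shows "es i (x - coord_proj smul e es B x) = (if i \<in> B then 0 else es i x)"
proof -
  have lin: "Vector_Spaces.linear smul (*) (es i)" and bl: "bounded_linear (es i)"
    using assms(1) by (auto simp: continuous_functional_def)
  have scale: "es i (smul c y) = c * es i y" for c y
    using lin by (simp add: Vector_Spaces.linear_iff)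
  interpret f: bounded_linear "es i" by (rule bl)
  show ?thesis
    by (simp add: coord_proj_def f.diff f.sum scale assms(2,3) if_distrib sum.delta' cong: if_cong)
qed

text \<open>An index outside \<open>A - B\<close> either lies outside \<open>A\<close>, where
  greediness of \<open>A\<close> applies, or lies in \<open>B\<close>, where the coefficient of
  \<open>y\<close> vanishes.\<close>

lemma greedy_set_residual:
  assumes "greedy_set es 1 x A"
    and "\<And>i. es i y = (if i \<in> B then 0 else es i x)"
  shows "greedy_set es 1 y (A - B)"
  using assms unfolding greedy_set_def by auto

text \<open>On \<open>A - B\<close> the coefficients of \<open>x\<close> and \<open>y\<close> agree,
  so the two successive projections add up to the one on \<open>A\<close>.\<close>

lemma coord_proj_residual:
  assumes "finite A" and "B \<subseteq> A" and "\<And>i. i \<in> A - B \<Longrightarrow> es i y = es i x"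
    and "y = x - coord_proj smul e es B x"
  shows "y - coord_proj smul e es (A - B) y = x - coord_proj smul e es A x"
  using assms(3,4) sum.subset_diff[OF assms(2,1), of "\<lambda>i. smul (es i x) (e i)"]
  by (simp add: coord_proj_def)

text \<open>Each summand has norm at most \<open>N * M * norm x\<close>, with \<open>N\<close> and
  \<open>M\<close> bounding the functionals and the basis vectors. The bound grows with
  \<open>card A\<close>, so it serves only for small sets.\<close>

lemma norm_coord_proj_le_card:
  assumes "banach_space_over smul" and "semi_normalized_markushevich_basis smul e es"
  obtains K where "K \<ge> 0" "\<And>x A. norm (coord_proj smul e es A x) \<le> real (card A) * K * norm x"
proof -
  obtain M N where M: "\<And>i. norm (e i) \<le> M" and N: "\<And>i. onorm (es i) \<le> N"
    using assms(2) by (auto simp: semi_normalized_markushevich_basis_def bdd_above_def)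
  have bl: "bounded_linear (es i)" for i
    using assms(2) by (simp add: semi_normalized_markushevich_basis_def continuous_functional_def)
  have "M \<ge> 0" using M[of 0] norm_ge_zero order_trans by blast
  have "N \<ge> 0" using N[of 0] onorm_pos_le[OF bl] order_trans by blast
  have summand: "norm (smul (es i x) (e i)) \<le> N * M * norm x" for i x
  proof -
    have "norm (es i x) \<le> N * norm x"
      using onorm[OF bl, of i x] mult_right_mono[OF N norm_ge_zero] by (meson order_trans)
    then have "norm (es i x) * norm (e i) \<le> N * norm x * M"
      using M \<open>N \<ge> 0\<close> by (intro mult_mono) auto
    then show ?thesis
      by (simp add: banach_space_over.norm_smul[OF assms(1)] mult_ac)
  qed
  have "norm (coord_proj smul e es A x) \<le> real (card A) * (N * M) * norm x" for x A
    using sum_norm_bound[of A "\<lambda>i. smul (es i x) (e i)" "N * M * norm x"] summand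
    by (simp add: coord_proj_def mult.assoc)
  then show thesis using that[of "N * M"] \<open>M \<ge> 0\<close> \<open>N \<ge> 0\<close> by simp
qed

text \<open>Strong induction on \<open>card A\<close>, with \<open>x\<close> arbitrary because each
  step replaces \<open>x\<close> by a residual.\<close>

lemma greedy_residual_bound:
  assumes space: "banach_space_over smul"
    and basis: "semi_normalized_markushevich_basis smul e es"
    and "m > 0"
    and contr: "\<And>x A. greedy_set es 1 x A \<Longrightarrow> card A = m \<Longrightarrow> norm (x - coord_proj smul e es A x) \<le> norm x"
  obtains C where "C \<ge> 0"
    "\<And>x A. greedy_set es 1 x A \<Longrightarrow> norm (x - coord_proj smul e es A x) \<le> C * norm x"
proof -
  obtain K where K: "K \<ge> 0" "\<And>x A. norm (coord_proj smul e es A x) \<le> real (card A) * K * norm x"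
    using norm_coord_proj_le_card[OF space basis] by blast
  \<comment> \<open>This is the cost when fewer than \<open>m\<close> indices remain: 1 for
    \<open>x\<close> itself and \<open>real m * K\<close> for its projection.\<close>
  define C where "C = 1 + real m * K"
  have "C \<ge> 0" using K(1) by (simp add: C_def)
  have "norm (x - coord_proj smul e es A x) \<le> C * norm x" if "greedy_set es 1 x A" for x A
    using that
  proof (induction "card A" arbitrary: A x rule: less_induct)
    case less
    show ?case
    proof (cases "card A < m")
      case True
      have "norm (x - coord_proj smul e es A x) \<le> norm x + norm (coord_proj smul e es A x)"
        by (rule norm_triangle_ineq4)
      also have "\<dots> \<le> norm x + real (card A) * K * norm x" using K(2) by simp
      also have "\<dots> \<le> norm x + real m * K * norm x"
        using True K(1) by (intro add_left_mono mult_right_mono) auto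
      finally show ?thesis by (simp add: C_def algebra_simps)
    next
      case False
      then obtain B where B: "B \<subseteq> A" "card B = m" "greedy_set es 1 x B"
        using greedy_set_subset[OF less.prems, of m] by auto
      have fin: "finite A" "finite B" using less.prems B(3) by (auto simp: greedy_set_def)
      define y where "y = x - coord_proj smul e es B x"
      have y: "es i y = (if i \<in> B then 0 else es i x)" for i
        unfolding y_def using basis fin(2)
        by (intro biorthogonal_coord_residual) (auto simp: semi_normalized_markushevich_basis_def)
      \<comment> \<open>The descent is strict because \<open>B\<close> has \<open>m > 0\<close>
        elements.\<close>
      have "card (A - B) < card A"
        using B(1,2) \<open>m > 0\<close> False fin by (simp add: card_Diff_subset)
      then have "norm (y - coord_proj smul e es (A - B) y) \<le> C * norm y"
        using less.hyps greedy_set_residual[OF less.prems y] by blast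
      \<comment> \<open>Since removing \<open>B\<close> does not increase the norm, the same
        \<open>C\<close> survives every step. A factor above 1 would accumulate.\<close>
      also have "\<dots> \<le> C * norm x"
        using contr[OF B(3,2)] \<open>C \<ge> 0\<close> by (simp add: y_def mult_left_mono)
      also have "y - coord_proj smul e es (A - B) y = x - coord_proj smul e es A x"
        using y by (intro coord_proj_residual[OF fin(1) B(1) _ y_def]) simp
      finally show ?thesis .
    qed
  qed
  then show thesis using that \<open>C \<ge> 0\<close> by blast
qed

theorem theorem3p6:
  fixes smul :: "'k::real_normed_field \<Rightarrow> 'a::banach \<Rightarrow> 'a"
    and e :: "nat \<Rightarrow> 'a" and es :: "nat \<Rightarrow> 'a \<Rightarrow> 'k"
    and n :: "nat \<Rightarrow> nat" and t :: real
  assumes "banach_space_over smul"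
    and "separable_space (euclidean :: 'a topology)"
    and "infinite_dimensional smul"
    and "semi_normalized_markushevich_basis smul e es"
    and "strict_mono n" and "\<And>i. n i > 0"
    and "0 < t" and "t \<le> 1"
    and "suppression_quasi_greedy smul e es n t 1"
  shows "quasi_greedy smul e es"
proof -
  \<comment> \<open>As \<open>t \<le> 1\<close>, a greedy set is \<open>t\<close>-greedy, so the
    suppression bound applies at the cardinality \<open>n 0\<close>.\<close>
  have "norm (x - coord_proj smul e es A x) \<le> norm x"
    if "greedy_set es 1 x A" "card A = n 0" for x A
    using assms(9) greedy_set_mono[OF that(1) assms(8)] that(2)
    by (auto simp: suppression_quasi_greedy_def suppression_bound_def)
  then obtain C where C: "C \<ge> 0"
      "\<And>x A. greedy_set es 1 x A \<Longrightarrow> norm (x - coord_proj smul e es A x) \<le> C * norm x"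
    using greedy_residual_bound[OF assms(1,4,6)] by blast
  \<comment> \<open>The projection is \<open>x\<close> minus its residual. The summand 1 also makes
    the constant positive, as \<open>quasi_greedy\<close> demands.\<close>
  have "norm (coord_proj smul e es A x) \<le> (1 + C) * norm x" if "greedy_set es 1 x A" for x A
    using C(2)[OF that] norm_triangle_ineq4[of x "x - coord_proj smul e es A x"]
    by (simp add: algebra_simps)
  then show ?thesis
    unfolding quasi_greedy_def using C(1) by (intro exI[of _ "1 + C"]) auto
qed

end
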